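(* Suppose $r>1$ and let $R=ae_1^\top$ be a singular point of $\mathcal{B}_{n,r}$ for some $a\in E^n$. Let $H=[0,H_1]\in\mathcal{T}^i_{\mathcal{B}_{n,r}}(R)=\mathcal{T}_{\mathcal{B}_{n,r}}(R)$, with $H_1\in\mathbb{R}^{n\times(r-1)}$. (i) If $H_1\notin a\mathbb{R}^{1\times(r-1)}$, then $$\mathcal{T}^{i,2}_{\mathcal{B}_{n,r}}(R,H)=\mathcal{T}^2_{\mathcal{B}_{n,r}}(R,H)=\left\{\left[-a\circ\mathrm{diag}(H_1H_1^\top),\,W_1\right]:\ a^\top\mathrm{diag}(H_1W_1^\top)=0,\ e^\top W_1=0,\ W_1\in\mathbb{R}^{n\times(r-1)}\right\}.$$ (ii) If $H_1=a\lambda^\top$ for some $\lambda\in\mathbb{R}^{r-1}$, then $$\mathcal{T}^{i,2}_{\mathcal{B}_{n,r}}(R,H)=\mathcal{T}^2_{\mathcal{B}_{n,r}}(R,H)=\left\{\left[-a\circ\mathrm{diag}(H_1H_1^\top),\,W_1\right]:\ a^\top\mathrm{diag}(W_1W_1^\top)=0,\ e^\top W_1=0,\ W_1\in\mathbb{R}^{n\times(r-1)}\right\}.$$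
   Context: $\mathcal{B}_{n,r}:=\{R\in\mathbb{R}^{n\times r}:\ \mathrm{diag}(RR^\top)=e,\ R^\top e=0\}$, where $e\in\mathbb{R}^n$ is the all-ones vector and $\mathrm{diag}(X)$ is the diagonal vector of the square matrix $X$. $E^n:=\{v\in\{-1,1\}^n:e^\top v=0\}$; $e_1\in\mathbb{R}^r$ is the first standard basis vector; $\circ$ is the entrywise product; $[x,M]$ is the matrix with first column $x$ followed by the columns of $M$. The points $ae_1^\top$, $a\in E^n$, are singular points of $\mathcal{B}_{n,r}$ (LICQ fails there). For a closed set $S$ and $x\in S$: $\mathcal{T}^i_S(x):=\{h:\mathrm{dist}(x+th,S)=o(t),\ t\ge0\}$ and $\mathcal{T}_S(x):=\{h:\exists t_k\downarrow0,\ \mathrm{dist}(x+t_kh,S)=o(t_k)\}$. At $R=ae_1^\top$ (with $r>1$) both equal $\{[0,H_1]:\ H_1\in\mathbb{R}^{n\times(r-1)},\ e^\top H_1=0,\ a^\top\mathrm{diag}(H_1H_1^\top)=0\}$. Inner second order tangent set: $\mathcal{T}^{i,2}_S(x,h):=\{w:\ \mathrm{dist}(x+th+\frac12t^2w,S)=o(t^2),\ t\ge0\}$ for $h\in\mathcal{T}^i_S(x)$; outer second order tangent set: $\mathcal{T}^2_S(x,h):=\{w:\ \exists t_k\downarrow0,\ \mathrm{dist}(x+t_kh+\frac12t_k^2w,S)=o(t_k^2)\}$ for $h\in\mathcal{T}_S(x)$. *)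

theory Defs
  imports "HOL-Analysis.Analysis" "HOL-Library.Landau_Symbols"
begin

(* The all-ones vector e is the library's 1 :: real ^ 'n, and the entrywise product of two
   vectors is the library's * on real ^ 'n.  The norm on real ^ 'r ^ 'n is the Frobenius norm.

   Matrices with r > 1 columns of which the first is singled out: their columns are indexed by
   'k option, where None is the first column and Some ranges over the other r - 1 = CARD('k)
   columns.  Since CARD('k) is an arbitrary positive number, r = CARD('k option) is an arbitrary
   number > 1. *)

lemma card_option_gt_1: "1 < CARD('k::finite option)"
  by (simp add: card_UNIV_option)

definition diag :: "real ^ 'n ^ 'n \<Rightarrow> real ^ 'n" where
  "diag X = (\<chi> i. X $ i $ i)"

definition outer_prod :: "real ^ 'n \<Rightarrow> real ^ 'm \<Rightarrow> real ^ 'm ^ 'n" where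
  "outer_prod x y = (\<chi> i j. x $ i * y $ j)"

definition first_col :: "real ^ 'n \<Rightarrow> real ^ 'k ^ 'n \<Rightarrow> real ^ ('k::finite option) ^ 'n" where
  "first_col x M = (\<chi> i j. case j of None \<Rightarrow> x $ i | Some k \<Rightarrow> M $ i $ k)"

definition BB :: "(real ^ 'r ^ 'n) set" where
  "BB = {R. diag (R ** transpose R) = 1 \<and> transpose R *v 1 = 0}"

definition EE :: "(real ^ 'n) set" where
  "EE = {v. (\<forall>i. v $ i \<in> {-1, 1}) \<and> 1 \<bullet> v = 0}"

(* The sets below are meant for a closed set S with x in S, and the second order ones for a
   tangent direction h.  In the inner sets the little-o is only in t > 0, because at t = 0 the
   distance vanishes.  A sequence t_k decreasing to 0 is read as a positive null sequence;
   monotonicity would make no difference, by passing to a subsequence. *)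

definition inner_tangent :: "'a::real_normed_vector set \<Rightarrow> 'a \<Rightarrow> 'a set" where
  "inner_tangent S x =
     {h. (\<lambda>t. infdist (x + t *\<^sub>R h) S) \<in> o[at_right 0](\<lambda>t. t)}"

definition inner_tangent2 :: "'a::real_normed_vector set \<Rightarrow> 'a \<Rightarrow> 'a \<Rightarrow> 'a set" where
  "inner_tangent2 S x h =
     {w. (\<lambda>t. infdist (x + t *\<^sub>R h + ((1/2) * t\<^sup>2) *\<^sub>R w) S) \<in> o[at_right 0](\<lambda>t. t\<^sup>2)}"

definition outer_tangent2 :: "'a::real_normed_vector set \<Rightarrow> 'a \<Rightarrow> 'a \<Rightarrow> 'a set" where
  "outer_tangent2 S x h =
     {w. \<exists>t::nat \<Rightarrow> real. (\<forall>k. 0 < t k) \<and> t \<longlonglongrightarrow> 0 \<and>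
           (\<lambda>k. infdist (x + t k *\<^sub>R h + ((1/2) * (t k)\<^sup>2) *\<^sub>R w) S)
             \<in> o[sequentially](\<lambda>k. (t k)\<^sup>2)}"

end

theory Submission
  imports Defs
begin

text \<open>
  Write a matrix near the singular point as a first column close to \<open>a\<close>, followed by a small
  block \<open>M\<close>. A second order perturbation with coefficient \<open>[y, Z]\<close> has \<open>M = t H1 + (t^2/2) Z\<close> and first
  column \<open>a + (t^2/2) y\<close>. After division by \<open>t^2\<close>, the condition that row \<open>i\<close> has unit length reads
  \<open>a_i y_i + |H1_i|^2 + t <H1_i, Z_i> + (t^2/4) (y_i^2 + |Z_i|^2) = 0\<close>, and the column sums require
  \<open>\<Sum> y_i = 0\<close> and \<open>\<Sum> Z_i = 0\<close> (lemma \<open>second_order_curve_in_BB_iff\<close>). In the limit \<open>t \<rightarrow> 0\<close> the rows force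
  \<open>y_i = - a_i |H1_i|^2\<close>. Everything else is contained in the combination of the rows with the
  weights \<open>a_i\<close> (lemma \<open>signed_row_sum\<close>). With \<open>B(M, N) = \<Sum> a_i <M_i, N_i>\<close>, and since \<open>B(H1, H1) = 0\<close>
  for a tangent direction, it says that
  \<open>\<Sum> y_i = - t (B(H1, Z) + (t/4) (\<Sum> a_i y_i^2 + B(Z, Z)))\<close>.

  Necessity: on the set the left side is zero. Dividing by \<open>t\<close> gives \<open>B(H1, W1) = 0\<close> in the limit.
  If \<open>H1\<close> is \<open>a\<close> times a row vector \<open>l\<close>, then \<open>B(H1, Z) = <l, \<Sum> Z_i>\<close> vanishes identically, one
  may divide by \<open>t^2\<close>, and since \<open>\<Sum> a_i y_i^2\<close> tends to \<open>|l|^4 \<Sum> a_i = 0\<close> the limit is \<open>B(W1, W1) = 0\<close>.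

  Sufficiency: the row equations can be solved for \<open>y\<close> by a function that is continuous up to
  \<open>t = 0\<close> (\<open>sphere_lift\<close>). Only \<open>\<Sum> y_i = 0\<close> is left, a single scalar equation, which the
  intermediate value theorem solves on a segment \<open>W1 + s V\<close>, \<open>-\<sigma> \<le> s \<le> \<sigma>\<close>, for every small \<open>\<sigma>\<close>
  (lemma \<open>inner_tangent2_sign_change\<close>). The sign change comes from the same formula for \<open>\<Sum> y_i\<close>: the
  first nonvanishing order is \<open>s B(H1, V)\<close> in the generic case and \<open>2 s B(W1, V) + s^2 B(V, V)\<close> in the
  degenerate one, and \<open>V\<close> can be chosen with \<open>B(H1, V) > 0\<close>, respectively \<open>B(W1, V) > 0\<close>, unless
  \<open>H1\<close>, respectively \<open>W1\<close>, is \<open>a\<close> times a row vector (lemma \<open>signed_form_positive_direction\<close>). If both are,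
  all rows of \<open>M\<close> have the same length, hence \<open>y\<close> is a multiple of \<open>a\<close> and has sum zero already.
  The inner set lies in the outer one, so these two halves also show that the sets agree.
\<close>

section \<open>Tangent sets through nearby points of the set\<close>

text \<open>Nearest points turn a distance of order \<open>o(s)\<close> into exact membership of a point whose offset,
  measured in units of \<open>s\<close>, tends to zero.\<close>

lemma smallo_infdist_obtains_points:
  fixes S :: "'a::euclidean_space set" and p :: "nat \<Rightarrow> 'a" and s :: "nat \<Rightarrow> real"
  assumes "closed S" "S \<noteq> {}" and pos: "\<And>k. 0 < s k"
    and small: "(\<lambda>k. infdist (p k) S) \<in> o(s)"
  obtains D where "\<And>k. p k + s k *\<^sub>R D k \<in> S" "D \<longlonglongrightarrow> 0"
proof -
  have "\<forall>k. \<exists>x\<in>S. infdist (p k) S = dist (p k) x"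
    using infdist_attains_inf[OF assms(1,2)] by metis
  then obtain x where x: "\<And>k. x k \<in> S" "\<And>k. infdist (p k) S = dist (p k) (x k)"
    by metis
  define D where "D k = (x k - p k) /\<^sub>R s k" for k
  have mem: "p k + s k *\<^sub>R D k \<in> S" for k
    using x(1)[of k] pos[of k] by (simp add: D_def)
  have "(\<lambda>k. infdist (p k) S / s k) \<longlonglongrightarrow> 0"
    using smalloD_tendsto[OF small] .
  moreover have "infdist (p k) S / s k = norm (D k)" for k
    using pos[of k] x(2)[of k] by (simp add: D_def dist_norm norm_minus_commute divide_inverse mult.commute)
  ultimately have "(\<lambda>k. norm (D k)) \<longlonglongrightarrow> 0"
    by simp
  then have "D \<longlonglongrightarrow> 0"
    by (simp add: tendsto_norm_zero_iff)
  with mem show thesis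
    by (rule that)
qed

text \<open>The error in the distance can be absorbed into the second order coefficient. Equations valid on
  \<open>S\<close> can then be used exactly along the sequence, and the limit is taken in the coefficient.\<close>

lemma outer_tangent2_obtains_points:
  fixes S :: "'a::euclidean_space set"
  assumes "closed S" "S \<noteq> {}" "w \<in> outer_tangent2 S x h"
  obtains t Y where "\<And>k. 0 < t k" "t \<longlonglongrightarrow> 0" "Y \<longlonglongrightarrow> w"
    "\<And>k::nat. x + t k *\<^sub>R h + (1/2 * (t k)\<^sup>2) *\<^sub>R Y k \<in> S"
proof -
  obtain t where t: "\<And>k::nat. 0 < t k" "t \<longlonglongrightarrow> 0"
    and small: "(\<lambda>k. infdist (x + t k *\<^sub>R h + ((1/2) * (t k)\<^sup>2) *\<^sub>R w) S) \<in> o(\<lambda>k. (t k)\<^sup>2)"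
    using assms(3) by (auto simp: outer_tangent2_def)
  have pos: "0 < (t k)\<^sup>2" for k
    using t(1)[of k] by simp
  obtain D where D: "\<And>k. (x + t k *\<^sub>R h + ((1/2) * (t k)\<^sup>2) *\<^sub>R w) + (t k)\<^sup>2 *\<^sub>R D k \<in> S" "D \<longlonglongrightarrow> 0"
    using smallo_infdist_obtains_points[OF assms(1,2) pos small] by blast
  define Y where "Y k = w + 2 *\<^sub>R D k" for k
  have "Y \<longlonglongrightarrow> w + 2 *\<^sub>R 0"
    unfolding Y_def by (intro tendsto_intros D)
  then have "Y \<longlonglongrightarrow> w"
    by simp
  moreover have "x + t k *\<^sub>R h + (1/2 * (t k)\<^sup>2) *\<^sub>R Y k \<in> S" for k
    using D(1)[of k] by (simp add: Y_def algebra_simps)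
  ultimately show thesis
    using that t by blast
qed

lemma filterlim_inverse_Suc_at_right:
  "filterlim (\<lambda>k. inverse (real (Suc k))) (at_right 0) sequentially"
  using LIMSEQ_inverse_real_of_nat by (auto simp: filterlim_at intro!: always_eventually)

lemma inner_tangent_obtains_points:
  fixes S :: "'a::euclidean_space set"
  assumes "closed S" "S \<noteq> {}" "h \<in> inner_tangent S x"
  obtains t Y where "\<And>k. 0 < t k" "t \<longlonglongrightarrow> 0" "Y \<longlonglongrightarrow> h" "\<And>k::nat. x + t k *\<^sub>R Y k \<in> S"
proof -
  define t where "t k = inverse (real (Suc k))" for k
  have pos: "0 < t k" for k
    by (simp add: t_def)
  have t: "t \<longlonglongrightarrow> 0"
    unfolding t_def by (rule LIMSEQ_inverse_real_of_nat)
  have "(\<lambda>k. infdist (x + t k *\<^sub>R h) S) \<in> o(\<lambda>k. t k)"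
    using landau_o.small.compose[OF _ filterlim_inverse_Suc_at_right] assms(3)
    by (auto simp: inner_tangent_def t_def)
  then obtain D where D: "\<And>k. (x + t k *\<^sub>R h) + t k *\<^sub>R D k \<in> S" "D \<longlonglongrightarrow> 0"
    by (rule smallo_infdist_obtains_points[OF assms(1,2) pos]) blast
  have "(\<lambda>k. h + D k) \<longlonglongrightarrow> h + 0"
    by (intro tendsto_intros D)
  then show thesis
    using that[of t "\<lambda>k. h + D k"] pos t D(1) by (simp add: algebra_simps)
qed

lemma inner_tangent2_subset_outer_tangent2: "inner_tangent2 S x h \<subseteq> outer_tangent2 S x h"
proof
  fix w assume w: "w \<in> inner_tangent2 S x h"
  show "w \<in> outer_tangent2 S x h"
    unfolding outer_tangent2_def mem_Collect_eq
  proof (intro exI conjI allI)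
    show "0 < inverse (real (Suc k))" for k
      by simp
    show "(\<lambda>k. inverse (real (Suc k))) \<longlonglongrightarrow> 0"
      by (rule LIMSEQ_inverse_real_of_nat)
    show "(\<lambda>k. infdist (x + inverse (real (Suc k)) *\<^sub>R h
             + ((1/2) * (inverse (real (Suc k)))\<^sup>2) *\<^sub>R w) S) \<in> o(\<lambda>k. (inverse (real (Suc k)))\<^sup>2)"
      using landau_o.small.compose[OF _ filterlim_inverse_Suc_at_right] w
      unfolding inner_tangent2_def by blast
  qed
qed

text \<open>The membership test dual to \<open>outer_tangent2_obtains_points\<close>. The coefficient \<open>Y\<close> may depend on \<open>t\<close> in
  an arbitrary way, so no curve has to be selected continuously.\<close>

lemma inner_tangent2I:
  assumes "\<And>\<epsilon>. 0 < \<epsilon> \<Longrightarrow>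
     \<forall>\<^sub>F t in at_right 0. \<exists>Y. dist Y w < \<epsilon> \<and> x + t *\<^sub>R h + (1/2 * t\<^sup>2) *\<^sub>R Y \<in> S"
  shows "w \<in> inner_tangent2 S x h"
  unfolding inner_tangent2_def mem_Collect_eq
proof (rule landau_o.smallI)
  fix c :: real assume "0 < c"
  show "\<forall>\<^sub>F t in at_right 0. norm (infdist (x + t *\<^sub>R h + ((1/2) * t\<^sup>2) *\<^sub>R w) S) \<le> c * norm (t\<^sup>2)"
    using assms[OF \<open>0 < c\<close>]
  proof (rule eventually_mono)
    fix t :: real
    assume "\<exists>Y. dist Y w < c \<and> x + t *\<^sub>R h + (1/2 * t\<^sup>2) *\<^sub>R Y \<in> S"
    then obtain Y where Y: "dist Y w < c" "x + t *\<^sub>R h + (1/2 * t\<^sup>2) *\<^sub>R Y \<in> S"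
      by blast
    have "infdist (x + t *\<^sub>R h + ((1/2) * t\<^sup>2) *\<^sub>R w) S
        \<le> dist (x + t *\<^sub>R h + (1/2 * t\<^sup>2) *\<^sub>R w) (x + t *\<^sub>R h + (1/2 * t\<^sup>2) *\<^sub>R Y)"
      by (rule infdist_le[OF Y(2)])
    also have "\<dots> = norm ((1/2 * t\<^sup>2) *\<^sub>R (w - Y))"
      by (simp add: dist_norm scaleR_diff_right)
    also have "\<dots> = 1/2 * t\<^sup>2 * dist Y w"
      by (simp add: dist_norm norm_minus_commute)
    also have "\<dots> \<le> t\<^sup>2 * c"
      using Y(1) by (intro mult_mono) auto
    finally show "norm (infdist (x + t *\<^sub>R h + ((1/2) * t\<^sup>2) *\<^sub>R w) S) \<le> c * norm (t\<^sup>2)"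
      by (simp add: infdist_nonneg mult.commute)
  qed
qed

section \<open>Matrices with a distinguished first column\<close>

definition other_cols :: "real ^ ('k::finite option) ^ 'n \<Rightarrow> real ^ 'k ^ 'n" where
  "other_cols Y = (\<chi> i k. Y $ i $ Some k)"

lemma first_col_column_other_cols: "first_col (column None Y) (other_cols Y) = Y"
  by (simp add: first_col_def column_def other_cols_def vec_eq_iff split: option.split)

lemma column_first_col [simp]: "column None (first_col x M) = x"
  by (simp add: first_col_def column_def vec_eq_iff)

lemma other_cols_first_col [simp]: "other_cols (first_col x M) = M"
  by (simp add: first_col_def other_cols_def vec_eq_iff)

lemma first_col_add: "first_col x M + first_col y N = first_col (x + y) (M + N)"
  by (simp add: first_col_def vec_eq_iff split: option.split)

lemma first_col_scaleR: "c *\<^sub>R first_col x M = first_col (c *\<^sub>R x) (c *\<^sub>R M)"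
  by (simp add: first_col_def vec_eq_iff split: option.split)

lemma outer_prod_axis_None: "outer_prod a (axis None 1) = first_col a 0"
  by (simp add: first_col_def outer_prod_def axis_def vec_eq_iff split: option.split)

lemma tendsto_column [tendsto_intros]:
  "(f \<longlongrightarrow> Y) F \<Longrightarrow> ((\<lambda>x. column j (f x)) \<longlongrightarrow> column j Y) F"
  unfolding column_def by (intro tendsto_intros)

lemma tendsto_other_cols [tendsto_intros]:
  "(f \<longlongrightarrow> Y) F \<Longrightarrow> ((\<lambda>x. other_cols (f x)) \<longlongrightarrow> other_cols Y) F"
  unfolding other_cols_def by (intro tendsto_intros)

lemma continuous_on_first_col [continuous_intros]:
  assumes "continuous_on A f" "continuous_on A g"
  shows "continuous_on A (\<lambda>x. first_col (f x) (g x) :: real ^ ('k::finite option) ^ 'n)"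
  unfolding first_col_def
proof (intro continuous_on_vec_lambda)
  fix i :: 'n and j :: "'k option"
  show "continuous_on A (\<lambda>x. case j of None \<Rightarrow> f x $ i | Some k \<Rightarrow> g x $ i $ k)"
    using assms by (cases j) (auto intro!: continuous_intros)
qed

lemma sum_option_UNIV:
  "(\<Sum>j\<in>UNIV. f j) = f None + (\<Sum>k\<in>UNIV. f (Some k :: 'k::finite option))"
  by (simp add: UNIV_option_conv sum.reindex)

lemma vector_one_mult_nth: "(1 v* M) $ k = (\<Sum>i\<in>UNIV. (M :: real ^ 'm ^ 'n) $ i $ k)"
  by (simp add: vector_matrix_mult_def)

lemma vector_one_mult_eq_0_iff: "1 v* M = 0 \<longleftrightarrow> (\<Sum>i\<in>UNIV. (M :: real ^ 'm ^ 'n) $ i) = 0"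
  by (simp add: vec_eq_iff vector_one_mult_nth)

lemma first_col_in_BB_iff:
  "first_col x M \<in> BB \<longleftrightarrow>
     (\<forall>i. (x $ i)\<^sup>2 + M $ i \<bullet> M $ i = 1) \<and> (\<Sum>i\<in>UNIV. x $ i) = 0 \<and> 1 v* M = 0"
proof -
  have "diag (first_col x M ** transpose (first_col x M)) $ i = (x $ i)\<^sup>2 + M $ i \<bullet> M $ i" for i
    by (simp add: diag_def matrix_matrix_mult_def transpose_def sum_option_UNIV first_col_def
        inner_vec_def power2_eq_square)
  moreover have "(transpose (first_col x M) *v 1) $ None = (\<Sum>i\<in>UNIV. x $ i)"
    "\<And>k. (transpose (first_col x M) *v 1) $ Some k = (1 v* M) $ k"
    by (simp_all add: matrix_vector_mult_def transpose_def first_col_def vector_one_mult_nth)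
  ultimately show ?thesis
    unfolding BB_def mem_Collect_eq vec_eq_iff[of "diag _"] vec_eq_iff[of "transpose _ *v _"]
      vec_eq_iff[of "_ v* _"] split_option_all
    by auto
qed

lemma closed_BB: "closed (BB :: (real ^ 'r ^ 'n) set)"
proof -
  have "closed {X :: real ^ 'r ^ 'n. diag (X ** transpose X) = 1}"
    unfolding diag_def matrix_matrix_mult_def transpose_def
    by (intro closed_Collect_eq continuous_intros)
  moreover have "closed {X :: real ^ 'r ^ 'n. transpose X *v 1 = 0}"
    unfolding matrix_vector_mult_def transpose_def
    by (intro closed_Collect_eq continuous_intros)
  ultimately show ?thesis
    unfolding BB_def by (rule closed_Collect_conj)
qed

lemma EE_square: "a \<in> EE \<Longrightarrow> a $ i * a $ i = 1"
  by (auto simp: EE_def dest!: spec[of _ i])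

lemma EE_sum: "a \<in> EE \<Longrightarrow> (\<Sum>i\<in>UNIV. a $ i) = 0"
  by (simp add: EE_def inner_vec_def)

lemma first_col_0_in_BB: "a \<in> EE \<Longrightarrow> first_col a 0 \<in> BB"
  by (simp add: first_col_in_BB_iff EE_sum EE_square power2_eq_square vector_one_mult_eq_0_iff)

section \<open>The signed quadratic form\<close>

definition signed_form :: "real ^ 'n \<Rightarrow> real ^ 'k ^ 'n \<Rightarrow> real ^ 'k ^ 'n \<Rightarrow> real" where
  "signed_form a M N = (\<Sum>i\<in>UNIV. a $ i * (M $ i \<bullet> N $ i))"

lemma diag_mult_transpose_nth: "diag (M ** transpose N) $ i = M $ i \<bullet> N $ i"
  by (simp add: diag_def matrix_matrix_mult_def transpose_def inner_vec_def)

lemma inner_diag_eq_signed_form: "a \<bullet> diag (M ** transpose N) = signed_form a M N"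
  by (simp add: inner_vec_def signed_form_def diag_mult_transpose_nth)

lemma signed_form_add_right: "signed_form a M (N + c *\<^sub>R V) = signed_form a M N + c * signed_form a M V"
  by (simp add: signed_form_def inner_add_right algebra_simps sum.distrib sum_distrib_left)

lemma signed_form_add_scaled:
  "signed_form a (M + c *\<^sub>R V) (M + c *\<^sub>R V)
     = signed_form a M M + 2 * c * signed_form a M V + c\<^sup>2 * signed_form a V V"
  by (simp add: signed_form_def inner_add_right inner_add_left inner_commute algebra_simps
      sum.distrib sum_distrib_left power2_eq_square)

lemma tendsto_signed_form [tendsto_intros]:
  assumes "(f \<longlongrightarrow> M) F" "(g \<longlongrightarrow> N) F"
  shows "((\<lambda>x. signed_form a (f x) (g x)) \<longlongrightarrow> signed_form a M N) F"
  unfolding signed_form_def by (intro tendsto_intros assms)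

text \<open>Since \<open>a_i^2 = 1\<close>, the form degenerates along multiples of \<open>a\<close>: it only sees the column sums of the
  other argument, which the constraints make zero. This is the source of the two cases.\<close>

lemma signed_form_outer_prod:
  assumes "a \<in> EE"
  shows "signed_form a (outer_prod a l) N = l \<bullet> (\<Sum>i\<in>UNIV. N $ i)"
proof -
  have "a $ i * (outer_prod a l $ i \<bullet> N $ i) = l \<bullet> N $ i" for i
    using EE_square[OF assms, of i]
    by (simp add: outer_prod_def inner_vec_def sum_distrib_left flip: mult.assoc)
  then show ?thesis
    by (simp add: signed_form_def inner_sum_right)
qed

text \<open>The functional \<open>signed_form a M\<close> has the gradient with rows \<open>a_i M_i\<close>. It vanishes on all matrices with
  zero column sums only if these rows are all equal, that is, \<open>a_i M_i = l\<close> for one \<open>l\<close>. Otherwise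
  two rows differ, and moving them in opposite directions along their difference increases it.\<close>

lemma signed_form_positive_direction:
  fixes M :: "real ^ 'k ^ 'n"
  assumes a: "a \<in> EE" and M: "M \<notin> range (outer_prod a)"
  obtains V where "1 v* V = 0" "0 < signed_form a M V"
proof -
  have "\<exists>i j. a $ i *\<^sub>R M $ i \<noteq> a $ j *\<^sub>R M $ j"
  proof (rule ccontr)
    assume "\<not> ?thesis"
    then have const: "a $ i *\<^sub>R M $ i = a $ j *\<^sub>R M $ j" for i j
      by blast
    obtain j :: 'n where True by blast
    have "M $ i = a $ i *\<^sub>R a $ j *\<^sub>R M $ j" for i
      using EE_square[OF a, of i] by (simp only: const[of j i]) simp
    moreover have "outer_prod a (a $ j *\<^sub>R M $ j) $ i = a $ i *\<^sub>R a $ j *\<^sub>R M $ j" for i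
      by (simp add: outer_prod_def vec_eq_iff)
    ultimately have "M = outer_prod a (a $ j *\<^sub>R M $ j)"
      unfolding vec_eq_iff[of M] by metis
    with M show False
      by blast
  qed
  then obtain i j where ij: "a $ i *\<^sub>R M $ i \<noteq> a $ j *\<^sub>R M $ j"
    by blast
  define u where "u = a $ i *\<^sub>R M $ i - a $ j *\<^sub>R M $ j"
  define V :: "real ^ 'k ^ 'n" where "V = axis i u - axis j u"
  have "signed_form a M V = (\<Sum>l\<in>UNIV. (a $ l *\<^sub>R M $ l) \<bullet> axis i u $ l)
      - (\<Sum>l\<in>UNIV. (a $ l *\<^sub>R M $ l) \<bullet> axis j u $ l)"
    by (simp add: signed_form_def V_def inner_diff_right right_diff_distrib sum_subtractf)
  also have "\<dots> = u \<bullet> u"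
    by (simp add: axis_def if_distrib cong: if_cong) (simp add: u_def inner_diff_left)
  finally have "0 < signed_form a M V"
    using ij by (simp add: u_def)
  moreover have "1 v* V = 0"
    by (simp add: vector_one_mult_eq_0_iff V_def axis_def sum_subtractf)
  ultimately show thesis
    using that by blast
qed

section \<open>The constraints along a second order curve\<close>

text \<open>The first order analogue of the expansion at the core of the proof: for a nearby point with offset
  \<open>t [y, Z]\<close>, the rows weighted by \<open>a_i\<close> add up to \<open>\<Sum> a_i y_i^2 + signed_form a Z Z = 0\<close> once the linear
  term, which is \<open>2 \<Sum> y_i\<close>, has vanished.\<close>

lemma first_order_constraints:
  assumes a: "a \<in> EE" and H: "first_col 0 H1 \<in> inner_tangent BB (first_col a 0)"
  shows "1 v* H1 = 0" "signed_form a H1 H1 = 0"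
proof -
  obtain t Y where t: "\<And>k. 0 < t k" and Y: "Y \<longlonglongrightarrow> first_col 0 H1"
    and mem: "\<And>k::nat. first_col a 0 + t k *\<^sub>R Y k \<in> BB"
    using inner_tangent_obtains_points[OF closed_BB _ H] first_col_0_in_BB[OF a] by blast
  define y where "y k = column None (Y k)" for k
  define Z where "Z k = other_cols (Y k)" for k
  have y: "y \<longlonglongrightarrow> 0" and Z: "Z \<longlonglongrightarrow> H1"
    using tendsto_column[OF Y, of None] tendsto_other_cols[OF Y] by (simp_all add: y_def[abs_def] Z_def[abs_def])
  have mem': "first_col (a + t k *\<^sub>R y k) (t k *\<^sub>R Z k) \<in> BB" for k
    using mem[of k] first_col_column_other_cols[of "Y k"]
    by (metis first_col_add first_col_scaleR add_0 y_def Z_def)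
  have Zsum: "1 v* Z k = 0" for k
    using mem'[of k] t[of k]
    by (simp add: first_col_in_BB_iff vector_one_mult_eq_0_iff flip: scaleR_sum_right)
  have "(\<lambda>k. \<Sum>i\<in>UNIV. Z k $ i) \<longlonglongrightarrow> (\<Sum>i\<in>UNIV. H1 $ i)"
    by (intro tendsto_intros Z)
  with Zsum show "1 v* H1 = 0"
    by (simp add: vector_one_mult_eq_0_iff LIMSEQ_const_iff)
  have zero: "(\<Sum>i\<in>UNIV. a $ i * (y k $ i)\<^sup>2) + signed_form a (Z k) (Z k) = 0" for k
  proof -
    have row: "2 * y k $ i + t k * (a $ i * (y k $ i)\<^sup>2 + a $ i * (Z k $ i \<bullet> Z k $ i)) = 0" for i
    proof -
      have "(a $ i + t k * y k $ i)\<^sup>2 + t k * (t k * (Z k $ i \<bullet> Z k $ i)) = 1"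
        using mem'[of k] by (simp add: first_col_in_BB_iff)
      then have "t k * (2 * a $ i * y k $ i + t k * ((y k $ i)\<^sup>2 + Z k $ i \<bullet> Z k $ i)) = 0"
        using EE_square[OF a, of i] by (simp add: power2_eq_square algebra_simps)
      then have "a $ i * (2 * a $ i * y k $ i + t k * ((y k $ i)\<^sup>2 + Z k $ i \<bullet> Z k $ i)) = 0"
        using t[of k] by simp
      then have "2 * ((a $ i * a $ i) * y k $ i)
          + t k * (a $ i * (y k $ i)\<^sup>2 + a $ i * (Z k $ i \<bullet> Z k $ i)) = 0"
        by (simp add: algebra_simps)
      then show ?thesis
        using EE_square[OF a, of i] by simp
    qed
    have "(\<Sum>i\<in>UNIV. y k $ i) = 0"
      using mem'[of k] t[of k] EE_sum[OF a]
      by (simp add: first_col_in_BB_iff sum.distrib flip: sum_distrib_left)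
    moreover have "(\<Sum>i\<in>UNIV. 2 * y k $ i + t k * (a $ i * (y k $ i)\<^sup>2 + a $ i * (Z k $ i \<bullet> Z k $ i))) = 0"
      using row by simp
    ultimately have "t k * ((\<Sum>i\<in>UNIV. a $ i * (y k $ i)\<^sup>2) + signed_form a (Z k) (Z k)) = 0"
      by (simp add: sum.distrib signed_form_def flip: sum_distrib_left)
    then show ?thesis
      using t[of k] by simp
  qed
  have "(\<lambda>k. (\<Sum>i\<in>UNIV. a $ i * (y k $ i)\<^sup>2) + signed_form a (Z k) (Z k))
      \<longlonglongrightarrow> (\<Sum>i\<in>UNIV. a $ i * (0 $ i)\<^sup>2) + signed_form a H1 H1"
    by (intro tendsto_intros y Z)
  then show "signed_form a H1 H1 = 0"
    by (simp add: zero LIMSEQ_const_iff)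
qed

text \<open>The terms of order below \<open>t^2\<close> cancel in the row equations, because \<open>H\<close> has no first column,
  so these equations can be divided by \<open>t^2\<close> before any limit is taken.\<close>

lemma second_order_curve_in_BB_iff:
  assumes a: "a \<in> EE" and H: "1 v* H1 = 0" and t: "0 < t"
  shows "first_col a 0 + t *\<^sub>R first_col 0 H1 + (1/2 * t\<^sup>2) *\<^sub>R first_col y Z \<in> BB \<longleftrightarrow>
    (\<forall>i. a $ i * y $ i + H1 $ i \<bullet> H1 $ i + t * (H1 $ i \<bullet> Z $ i)
         + t\<^sup>2 / 4 * ((y $ i)\<^sup>2 + Z $ i \<bullet> Z $ i) = 0)
    \<and> (\<Sum>i\<in>UNIV. y $ i) = 0 \<and> 1 v* Z = 0"
proof -
  let ?c = "1/2 * t\<^sup>2"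
  have eq: "first_col a 0 + t *\<^sub>R first_col 0 H1 + ?c *\<^sub>R first_col y Z
      = first_col (a + ?c *\<^sub>R y) (t *\<^sub>R H1 + ?c *\<^sub>R Z)"
    by (simp add: first_col_add first_col_scaleR)
  have row: "((a + ?c *\<^sub>R y) $ i)\<^sup>2 + (t *\<^sub>R H1 + ?c *\<^sub>R Z) $ i \<bullet> (t *\<^sub>R H1 + ?c *\<^sub>R Z) $ i
      = 1 + t\<^sup>2 * (a $ i * y $ i + H1 $ i \<bullet> H1 $ i + t * (H1 $ i \<bullet> Z $ i)
         + t\<^sup>2 / 4 * ((y $ i)\<^sup>2 + Z $ i \<bullet> Z $ i))" for i
    using EE_square[OF a, of i]
    by (simp add: inner_add_left inner_add_right inner_commute power2_eq_square algebra_simps)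
  have y: "(\<Sum>i\<in>UNIV. (a + ?c *\<^sub>R y) $ i) = ?c * (\<Sum>i\<in>UNIV. y $ i)"
    by (simp add: sum.distrib EE_sum[OF a] sum_distrib_left)
  have Z: "(\<Sum>i\<in>UNIV. (t *\<^sub>R H1 + ?c *\<^sub>R Z) $ i) = ?c *\<^sub>R (\<Sum>i\<in>UNIV. Z $ i)"
    using H by (simp add: sum.distrib vector_one_mult_eq_0_iff flip: scaleR_sum_right)
  show ?thesis
    unfolding eq first_col_in_BB_iff row vector_one_mult_eq_0_iff y Z
    using t by simp
qed

text \<open>Row \<open>i\<close> is multiplied by \<open>a_i\<close>, which turns \<open>a_i y_i\<close> into \<open>y_i\<close>. The constant terms then add up to
  \<open>signed_form a H1 H1 = 0\<close>, and this gains the extra factor \<open>t\<close>.\<close>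

lemma signed_row_sum:
  assumes a: "a \<in> EE" and q: "signed_form a H1 H1 = 0"
    and row: "\<And>i. a $ i * y $ i + H1 $ i \<bullet> H1 $ i + t * (H1 $ i \<bullet> Z $ i)
         + t\<^sup>2 / 4 * ((y $ i)\<^sup>2 + Z $ i \<bullet> Z $ i) = 0"
  shows "(\<Sum>i\<in>UNIV. y $ i) =
    - (t * (signed_form a H1 Z + t / 4 * ((\<Sum>i\<in>UNIV. a $ i * (y $ i)\<^sup>2) + signed_form a Z Z)))"
proof -
  have "0 = (\<Sum>i\<in>UNIV. a $ i * (a $ i * y $ i + H1 $ i \<bullet> H1 $ i + t * (H1 $ i \<bullet> Z $ i)
         + t\<^sup>2 / 4 * ((y $ i)\<^sup>2 + Z $ i \<bullet> Z $ i)))"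
    using row by simp
  also have "\<dots> = (\<Sum>i\<in>UNIV. (y $ i + a $ i * (H1 $ i \<bullet> H1 $ i)) + (t * (a $ i * (H1 $ i \<bullet> Z $ i))
         + t\<^sup>2 / 4 * (a $ i * (y $ i)\<^sup>2 + a $ i * (Z $ i \<bullet> Z $ i))))"
  proof (rule sum.cong[OF refl])
    fix i
    have expand: "b * (b * x + p + t * q + c * (r + s)) = ((b * b) * x + b * p) + (t * (b * q) + c * (b * r + b * s))"
      for b x p q c r s :: real
      by (simp add: algebra_simps)
    show "a $ i * (a $ i * y $ i + H1 $ i \<bullet> H1 $ i + t * (H1 $ i \<bullet> Z $ i)
         + t\<^sup>2 / 4 * ((y $ i)\<^sup>2 + Z $ i \<bullet> Z $ i))
      = (y $ i + a $ i * (H1 $ i \<bullet> H1 $ i)) + (t * (a $ i * (H1 $ i \<bullet> Z $ i))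
         + t\<^sup>2 / 4 * (a $ i * (y $ i)\<^sup>2 + a $ i * (Z $ i \<bullet> Z $ i)))"
      unfolding expand EE_square[OF a] by simp
  qed
  also have "\<dots> = ((\<Sum>i\<in>UNIV. y $ i) + signed_form a H1 H1) + (t * signed_form a H1 Z
      + t\<^sup>2 / 4 * ((\<Sum>i\<in>UNIV. a $ i * (y $ i)\<^sup>2) + signed_form a Z Z))"
    by (simp only: sum.distrib signed_form_def flip: sum_distrib_left)
  finally show ?thesis
    using q by (simp add: power2_eq_square algebra_simps)
qed

text \<open>In the degenerate case all \<open>|H1_i|\<close> are equal, so the weights \<open>a_i\<close> cancel the contribution of the
  first column to the limit at order \<open>t^2\<close>.\<close>

lemma signed_sum_limit_squares:
  assumes a: "a \<in> EE" and H: "H1 = outer_prod a l" and w: "\<And>i. w $ i = - a $ i * (H1 $ i \<bullet> H1 $ i)"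
  shows "(\<Sum>i\<in>UNIV. a $ i * (w $ i)\<^sup>2) = 0"
proof -
  have "H1 $ i \<bullet> H1 $ i = (a $ i * a $ i) * (l \<bullet> l)" for i
    by (simp add: H outer_prod_def inner_vec_def sum_distrib_left algebra_simps)
  then have "(w $ i)\<^sup>2 = (l \<bullet> l)\<^sup>2" for i
    using EE_square[OF a, of i] by (simp add: w power_mult_distrib power2_eq_square)
  then show ?thesis
    by (simp add: EE_sum[OF a] flip: sum_distrib_right)
qed

section \<open>Necessary conditions\<close>

lemma outer_tangent2_necessary:
  fixes H1 :: "real ^ 'k::finite ^ 'n"
  assumes a: "a \<in> EE" and H: "1 v* H1 = 0" and q: "signed_form a H1 H1 = 0"
    and w: "w \<in> outer_tangent2 BB (first_col a 0) (first_col 0 H1)"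
  obtains W1 where "w = first_col (- a * diag (H1 ** transpose H1)) W1" "1 v* W1 = 0"
    "signed_form a H1 W1 = 0" "\<And>l. H1 = outer_prod a l \<Longrightarrow> signed_form a W1 W1 = 0"
proof -
  obtain t Y where t: "\<And>k. 0 < t k" "t \<longlonglongrightarrow> 0" and Y: "Y \<longlonglongrightarrow> w"
    and mem: "\<And>k::nat. first_col a 0 + t k *\<^sub>R first_col 0 H1 + (1/2 * (t k)\<^sup>2) *\<^sub>R Y k \<in> BB"
    using outer_tangent2_obtains_points[OF closed_BB _ w] first_col_0_in_BB[OF a] by blast
  define y where "y k = column None (Y k)" for k
  define Z where "Z k = other_cols (Y k)" for k
  define v where "v = column None w"
  define W1 where "W1 = other_cols w"
  have y: "y \<longlonglongrightarrow> v" and Z: "Z \<longlonglongrightarrow> W1"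
    using tendsto_column[OF Y, of None] tendsto_other_cols[OF Y]
    by (simp_all add: y_def[abs_def] Z_def[abs_def] v_def W1_def)
  have mem': "(\<forall>i. a $ i * y k $ i + H1 $ i \<bullet> H1 $ i + t k * (H1 $ i \<bullet> Z k $ i)
         + (t k)\<^sup>2 / 4 * ((y k $ i)\<^sup>2 + Z k $ i \<bullet> Z k $ i) = 0)
    \<and> (\<Sum>i\<in>UNIV. y k $ i) = 0 \<and> 1 v* Z k = 0" for k
    using mem[of k] second_order_curve_in_BB_iff[OF a H t(1)[of k], of "y k" "Z k"]
    by (simp add: y_def Z_def first_col_column_other_cols)
  have v: "v $ i = - a $ i * (H1 $ i \<bullet> H1 $ i)" for i
  proof -
    have "(\<lambda>k. a $ i * y k $ i + H1 $ i \<bullet> H1 $ i + t k * (H1 $ i \<bullet> Z k $ i)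
         + (t k)\<^sup>2 / 4 * ((y k $ i)\<^sup>2 + Z k $ i \<bullet> Z k $ i))
      \<longlonglongrightarrow> a $ i * v $ i + H1 $ i \<bullet> H1 $ i + 0 * (H1 $ i \<bullet> W1 $ i)
         + 0\<^sup>2 / 4 * ((v $ i)\<^sup>2 + W1 $ i \<bullet> W1 $ i)"
      by (intro tendsto_intros y Z t) auto
    then have "a $ i * v $ i + H1 $ i \<bullet> H1 $ i = 0"
      using mem' by (simp add: LIMSEQ_const_iff)
    then have "a $ i * (a $ i * v $ i + H1 $ i \<bullet> H1 $ i) = 0"
      by simp
    then show ?thesis
      using EE_square[OF a, of i] by (simp add: distrib_left flip: mult.assoc)
  qed
  have "w = first_col v W1"
    by (simp add: v_def W1_def first_col_column_other_cols)
  moreover have "v = - a * diag (H1 ** transpose H1)"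
    by (simp add: vec_eq_iff v diag_mult_transpose_nth)
  ultimately have weq: "w = first_col (- a * diag (H1 ** transpose H1)) W1"
    by simp
  have "(\<lambda>k. \<Sum>i\<in>UNIV. Z k $ i) \<longlonglongrightarrow> (\<Sum>i\<in>UNIV. W1 $ i)"
    by (intro tendsto_intros Z)
  with mem' have W1sum: "1 v* W1 = 0"
    by (simp add: vector_one_mult_eq_0_iff LIMSEQ_const_iff)
  have zero: "signed_form a H1 (Z k)
      + t k / 4 * ((\<Sum>i\<in>UNIV. a $ i * (y k $ i)\<^sup>2) + signed_form a (Z k) (Z k)) = 0" for k
    using signed_row_sum[OF a q, of "y k" "t k" "Z k"] mem'[of k] t(1)[of k] by simp
  have "(\<lambda>k. signed_form a H1 (Z k)
      + t k / 4 * ((\<Sum>i\<in>UNIV. a $ i * (y k $ i)\<^sup>2) + signed_form a (Z k) (Z k)))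
      \<longlonglongrightarrow> signed_form a H1 W1 + 0 / 4 * ((\<Sum>i\<in>UNIV. a $ i * (v $ i)\<^sup>2) + signed_form a W1 W1)"
    by (intro tendsto_intros y Z t) auto
  then have HW: "signed_form a H1 W1 = 0"
    unfolding zero by (simp add: LIMSEQ_const_iff)
  have "signed_form a W1 W1 = 0" if l: "H1 = outer_prod a l" for l
  proof -
    have "signed_form a H1 (Z k) = 0" for k
      using mem'[of k] by (simp add: l signed_form_outer_prod[OF a] vector_one_mult_eq_0_iff)
    then have zero2: "(\<Sum>i\<in>UNIV. a $ i * (y k $ i)\<^sup>2) + signed_form a (Z k) (Z k) = 0" for k
      using zero[of k] t(1)[of k] by simp
    have "(\<lambda>k. (\<Sum>i\<in>UNIV. a $ i * (y k $ i)\<^sup>2) + signed_form a (Z k) (Z k))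
        \<longlonglongrightarrow> (\<Sum>i\<in>UNIV. a $ i * (v $ i)\<^sup>2) + signed_form a W1 W1"
      by (intro tendsto_intros y Z)
    then show ?thesis
      using signed_sum_limit_squares[OF a l v] by (simp add: zero2 LIMSEQ_const_iff)
  qed
  with weq W1sum HW show thesis
    using that by blast
qed

section \<open>Construction of curves\<close>

text \<open>The root \<open>y_i\<close> of the quadratic row equation for which \<open>a_i + (t^2/2) y_i\<close> stays near \<open>a_i\<close>. In terms of
  \<open>m = |H1_i + (t/2) Z_i|^2\<close> it is \<open>- 2 a_i (1 - sqrt (1 - t^2 m)) / t^2\<close>. It is written here with a
  rationalized numerator, which makes sense at \<open>t = 0\<close>. The absolute value keeps the denominator
  positive, hence the function continuous everywhere; the row equation is solved where \<open>t^2 m \<le> 1\<close>.\<close>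

definition sphere_lift :: "real ^ 'n \<Rightarrow> real ^ 'k ^ 'n \<Rightarrow> real \<Rightarrow> real ^ 'k ^ 'n \<Rightarrow> real ^ 'n" where
  "sphere_lift a H1 t Z = (\<chi> i. let m = (H1 $ i + (t/2) *\<^sub>R Z $ i) \<bullet> (H1 $ i + (t/2) *\<^sub>R Z $ i)
     in - 2 * a $ i * m / (1 + sqrt \<bar>1 - t\<^sup>2 * m\<bar>))"

lemma continuous_on_sphere_lift [continuous_intros]:
  assumes "continuous_on A f" "continuous_on A g"
  shows "continuous_on A (\<lambda>x. sphere_lift a H1 (f x) (g x))"
proof -
  have "1 + sqrt \<bar>c\<bar> \<noteq> 0" for c :: real
    using real_sqrt_ge_zero[of "\<bar>c\<bar>"] by linarith
  then show ?thesis
    unfolding sphere_lift_def Let_def using assms by (intro continuous_intros) auto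
qed

lemma sphere_lift_0: "sphere_lift a H1 0 Z = - a * diag (H1 ** transpose H1)"
  by (simp add: sphere_lift_def vec_eq_iff diag_mult_transpose_nth)

lemma sphere_lift_row:
  assumes a: "a \<in> EE"
    and small: "t\<^sup>2 * ((H1 $ i + (t/2) *\<^sub>R Z $ i) \<bullet> (H1 $ i + (t/2) *\<^sub>R Z $ i)) \<le> 1"
  shows "a $ i * sphere_lift a H1 t Z $ i + H1 $ i \<bullet> H1 $ i + t * (H1 $ i \<bullet> Z $ i)
         + t\<^sup>2 / 4 * ((sphere_lift a H1 t Z $ i)\<^sup>2 + Z $ i \<bullet> Z $ i) = 0"
proof -
  define m where "m = (H1 $ i + (t/2) *\<^sub>R Z $ i) \<bullet> (H1 $ i + (t/2) *\<^sub>R Z $ i)"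
  define p where "p = sqrt (1 - t\<^sup>2 * m)"
  define y where "y = sphere_lift a H1 t Z $ i"
  have p: "0 \<le> p" "p\<^sup>2 = 1 - t\<^sup>2 * m"
    using small by (simp_all add: p_def m_def)
  have y: "y = - 2 * a $ i * m / (1 + p)"
    using small by (simp add: y_def sphere_lift_def p_def Let_def flip: m_def)
  have "a $ i * y = - 2 * m / (1 + p)"
    using EE_square[OF a, of i] by (simp add: y mult.left_commute)
  moreover have "y\<^sup>2 = 4 * m\<^sup>2 / (1 + p)\<^sup>2"
    using EE_square[OF a, of i] by (simp add: y power_divide power_mult_distrib power2_eq_square[of "a $ i"])
  moreover have "t\<^sup>2 * m\<^sup>2 = m * ((1 - p) * (1 + p))"
  proof -
    have "t\<^sup>2 * m\<^sup>2 = m * (1 - p\<^sup>2)"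
      unfolding p(2) by (simp add: power2_eq_square)
    also have "1 - p\<^sup>2 = (1 - p) * (1 + p)"
      by (simp add: algebra_simps power2_eq_square)
    finally show ?thesis .
  qed
  ultimately have "a $ i * y + m + t\<^sup>2 / 4 * y\<^sup>2
      = - 2 * m / (1 + p) + m + m * ((1 - p) * (1 + p)) / (1 + p)\<^sup>2"
    by simp
  also have "\<dots> = 0"
    using p(1) by (simp add: divide_simps power2_eq_square) (simp add: algebra_simps)
  finally have "a $ i * y + m + t\<^sup>2 / 4 * y\<^sup>2 = 0" .
  moreover have "m = H1 $ i \<bullet> H1 $ i + t * (H1 $ i \<bullet> Z $ i) + t\<^sup>2 / 4 * (Z $ i \<bullet> Z $ i)"
    by (simp add: m_def inner_add_left inner_add_right inner_commute power2_eq_square)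
  ultimately show ?thesis
    by (simp add: y_def distrib_left)
qed

lemma eventually_sphere_lift_row:
  assumes a: "a \<in> EE"
  shows "\<forall>\<^sub>F (t, Z) in nhds (0, W). \<forall>i. a $ i * sphere_lift a H1 t Z $ i + H1 $ i \<bullet> H1 $ i
     + t * (H1 $ i \<bullet> Z $ i) + t\<^sup>2 / 4 * ((sphere_lift a H1 t Z $ i)\<^sup>2 + Z $ i \<bullet> Z $ i) = 0"
proof -
  let ?f = "\<lambda>i p. (fst p)\<^sup>2 * ((H1 $ i + (fst p/2) *\<^sub>R snd p $ i) \<bullet> (H1 $ i + (fst p/2) *\<^sub>R snd p $ i))"
  have "\<forall>\<^sub>F p in nhds (0, W). ?f i p < 1" for i
  proof -
    have "open {p. ?f i p < 1}"
      by (intro open_Collect_less continuous_intros) auto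
    then show ?thesis
      by (auto simp: eventually_nhds intro!: exI[of _ "{p. ?f i p < 1}"])
  qed
  then have "\<forall>\<^sub>F p in nhds (0, W). \<forall>i. ?f i p < 1"
    by (simp add: eventually_all_finite)
  then show ?thesis
    unfolding case_prod_unfold
    by (rule eventually_mono) (blast intro: sphere_lift_row[OF a] less_imp_le)
qed

text \<open>Continuity at \<open>(0, W1)\<close> keeps all lifts over the segment close to the target, uniformly for small
  \<open>t\<close>, so any zero of the sum on the segment gives an admissible point. The sign condition is
  not strict, so that \<open>V = 0\<close> covers the case in which the sum vanishes at \<open>W1\<close> itself.\<close>

lemma inner_tangent2_sign_change:
  fixes H1 W1 V :: "real ^ 'k::finite ^ 'n"
  assumes a: "a \<in> EE" and H: "1 v* H1 = 0" and W: "1 v* W1 = 0" and V: "1 v* V = 0"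
    and sign: "\<forall>\<^sub>F \<sigma> in at_right 0. \<forall>\<^sub>F t in at_right 0.
       (\<Sum>i\<in>UNIV. sphere_lift a H1 t (W1 + (-\<sigma>) *\<^sub>R V) $ i)
         * (\<Sum>i\<in>UNIV. sphere_lift a H1 t (W1 + \<sigma> *\<^sub>R V) $ i) \<le> 0"
  shows "first_col (- a * diag (H1 ** transpose H1)) W1
           \<in> inner_tangent2 BB (first_col a 0) (first_col 0 H1)" (is "?w \<in> _")
proof (rule inner_tangent2I)
  fix \<epsilon> :: real assume "0 < \<epsilon>"
  define P where "P t Z \<longleftrightarrow> dist (first_col (sphere_lift a H1 t Z) Z) ?w < \<epsilon> \<and>
     (\<forall>i. a $ i * sphere_lift a H1 t Z $ i + H1 $ i \<bullet> H1 $ i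
     + t * (H1 $ i \<bullet> Z $ i) + t\<^sup>2 / 4 * ((sphere_lift a H1 t Z $ i)\<^sup>2 + Z $ i \<bullet> Z $ i) = 0)"
    for t Z
  have "open {p. dist (first_col (sphere_lift a H1 (fst p) (snd p)) (snd p)) ?w < \<epsilon>}"
    by (intro open_Collect_less continuous_intros)
  then have "\<forall>\<^sub>F p in nhds (0, W1). dist (first_col (sphere_lift a H1 (fst p) (snd p)) (snd p)) ?w < \<epsilon>"
    using \<open>0 < \<epsilon>\<close> by (intro eventually_nhds_in_open[THEN eventually_mono]) (auto simp: sphere_lift_0)
  then have "\<forall>\<^sub>F p in nhds (0, W1). P (fst p) (snd p)"
    using eventually_sphere_lift_row[OF a, of H1 W1] unfolding case_prod_unfold P_def
    by (rule eventually_conj)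
  then obtain \<delta> where \<delta>: "0 < \<delta>" "\<And>t Z. dist (t, Z) (0, W1) < \<delta> \<Longrightarrow> P t Z"
    unfolding eventually_nhds_metric by (metis fst_conv snd_conv)
  have near: "P t Z" if "\<bar>t\<bar> < \<delta> / 2" "norm (Z - W1) < \<delta> / 2" for t Z
  proof (rule \<delta>(2))
    have "dist (t, Z) (0, W1) \<le> \<bar>t\<bar> + norm (Z - W1)"
      using sqrt_sum_squares_le_sum_abs[of "dist t 0" "dist Z W1"]
      by (simp only: dist_Pair_Pair) (simp add: dist_norm)
    with that show "dist (t, Z) (0, W1) < \<delta>"
      by linarith
  qed
  have "((\<lambda>\<sigma>. \<sigma> * norm V) \<longlongrightarrow> 0 * norm V) (at_right 0)"
    by (intro tendsto_intros)
  then have "\<forall>\<^sub>F \<sigma> in at_right 0. \<sigma> * norm V < \<delta> / 2"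
    using \<delta>(1) by (intro order_tendstoD(2)) auto
  then have "\<forall>\<^sub>F \<sigma> in at_right 0. 0 < \<sigma> \<and> \<sigma> * norm V < \<delta> / 2 \<and> (\<forall>\<^sub>F t in at_right 0.
       (\<Sum>i\<in>UNIV. sphere_lift a H1 t (W1 + (-\<sigma>) *\<^sub>R V) $ i)
         * (\<Sum>i\<in>UNIV. sphere_lift a H1 t (W1 + \<sigma> *\<^sub>R V) $ i) \<le> 0)"
    using sign eventually_at_right_less[of 0] by eventually_elim auto
  then obtain \<sigma> where \<sigma>: "0 < \<sigma>" "\<sigma> * norm V < \<delta> / 2"
    and sign': "\<forall>\<^sub>F t in at_right 0.
       (\<Sum>i\<in>UNIV. sphere_lift a H1 t (W1 + (-\<sigma>) *\<^sub>R V) $ i)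
         * (\<Sum>i\<in>UNIV. sphere_lift a H1 t (W1 + \<sigma> *\<^sub>R V) $ i) \<le> 0"
    using eventually_happens'[OF trivial_limit_at_right_real] by blast
  have "\<forall>\<^sub>F t in at_right (0::real). t < \<delta> / 2"
    using \<delta>(1) by (intro order_tendstoD(2)[of _ 0]) (auto intro: tendsto_ident_at)
  with sign' eventually_at_right_less[of 0]
  show "\<forall>\<^sub>F t in at_right 0. \<exists>Y. dist Y ?w < \<epsilon> \<and>
      first_col a 0 + t *\<^sub>R first_col 0 H1 + (1/2 * t\<^sup>2) *\<^sub>R Y \<in> BB"
  proof eventually_elim
    fix t :: real
    assume "0 < t" "t < \<delta> / 2"
    define f where "f s = (\<Sum>i\<in>UNIV. sphere_lift a H1 t (W1 + s *\<^sub>R V) $ i)" for s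
    assume "(\<Sum>i\<in>UNIV. sphere_lift a H1 t (W1 + (-\<sigma>) *\<^sub>R V) $ i)
         * (\<Sum>i\<in>UNIV. sphere_lift a H1 t (W1 + \<sigma> *\<^sub>R V) $ i) \<le> 0"
    then have "f (-\<sigma>) * f \<sigma> \<le> 0"
      by (simp add: f_def)
    then have "f (-\<sigma>) \<le> 0 \<and> 0 \<le> f \<sigma> \<or> 0 \<le> f (-\<sigma>) \<and> f \<sigma> \<le> 0"
      by (auto simp: mult_le_0_iff)
    moreover have cont: "continuous_on {-\<sigma>..\<sigma>} f"
      unfolding f_def by (intro continuous_intros)
    ultimately obtain s where s: "-\<sigma> \<le> s" "s \<le> \<sigma>" "f s = 0"
      using IVT'[of f "-\<sigma>" 0 \<sigma>] IVT2'[of f \<sigma> 0 "-\<sigma>"] \<sigma>(1) by force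
    define Z where "Z = W1 + s *\<^sub>R V"
    have "norm (Z - W1) \<le> \<sigma> * norm V"
      using s by (auto simp: Z_def intro!: mult_right_mono)
    then have P: "P t Z"
      using near[of t Z] \<open>0 < t\<close> \<open>t < \<delta> / 2\<close> \<sigma>(2) by simp
    have "1 v* Z = 0"
      using W V by (simp add: Z_def vector_one_mult_eq_0_iff sum.distrib flip: scaleR_sum_right)
    then have "first_col a 0 + t *\<^sub>R first_col 0 H1 + (1/2 * t\<^sup>2) *\<^sub>R first_col (sphere_lift a H1 t Z) Z \<in> BB"
      using P s(3) unfolding P_def second_order_curve_in_BB_iff[OF a H \<open>0 < t\<close>]
      by (simp add: f_def Z_def)
    with P show "\<exists>Y. dist Y ?w < \<epsilon> \<and>
      first_col a 0 + t *\<^sub>R first_col 0 H1 + (1/2 * t\<^sup>2) *\<^sub>R Y \<in> BB"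
      unfolding P_def by blast
  qed
qed

lemma tendsto_sphere_lift:
  "((\<lambda>t. sphere_lift a H1 t Z) \<longlongrightarrow> - a * diag (H1 ** transpose H1)) (at_right 0)"
proof -
  have "continuous_on UNIV (\<lambda>t. sphere_lift a H1 t Z)"
    by (intro continuous_intros)
  then have "((\<lambda>t. sphere_lift a H1 t Z) \<longlongrightarrow> sphere_lift a H1 0 Z) (at 0)"
    by (simp add: continuous_on_def)
  then show ?thesis
    unfolding sphere_lift_0 by (rule tendsto_within_subset) simp
qed

lemma eventually_sphere_lift_sum:
  assumes a: "a \<in> EE" and q: "signed_form a H1 H1 = 0"
  shows "\<forall>\<^sub>F t in at_right 0. (\<Sum>i\<in>UNIV. sphere_lift a H1 t Z $ i) =
    - (t * (signed_form a H1 Z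
        + t / 4 * ((\<Sum>i\<in>UNIV. a $ i * (sphere_lift a H1 t Z $ i)\<^sup>2) + signed_form a Z Z)))"
proof -
  have "((\<lambda>t::real. (t, Z)) \<longlongrightarrow> (0, Z)) (at_right 0)"
    by (intro tendsto_intros)
  from eventually_compose_filterlim[OF eventually_sphere_lift_row[OF a, of H1 Z] this]
  have "\<forall>\<^sub>F t in at_right 0. \<forall>i. a $ i * sphere_lift a H1 t Z $ i + H1 $ i \<bullet> H1 $ i
     + t * (H1 $ i \<bullet> Z $ i) + t\<^sup>2 / 4 * ((sphere_lift a H1 t Z $ i)\<^sup>2 + Z $ i \<bullet> Z $ i) = 0"
    by simp
  then show ?thesis
    by (rule eventually_mono) (rule signed_row_sum[OF a q], blast)
qed

text \<open>Up to the factor \<open>- t\<close>, the sum of the lift at \<open>W1 + s V\<close> tends to \<open>s * signed_form a H1 V\<close> as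
  \<open>t \<rightarrow> 0\<close>, which changes sign with \<open>s\<close>.\<close>

lemma inner_tangent2_generic:
  fixes H1 W1 :: "real ^ 'k::finite ^ 'n"
  assumes a: "a \<in> EE" and H: "1 v* H1 = 0" and q: "signed_form a H1 H1 = 0"
    and generic: "H1 \<notin> range (outer_prod a)"
    and W: "1 v* W1 = 0" and HW: "signed_form a H1 W1 = 0"
  shows "first_col (- a * diag (H1 ** transpose H1)) W1
           \<in> inner_tangent2 BB (first_col a 0) (first_col 0 H1)"
proof -
  obtain V where V: "1 v* V = 0" "0 < signed_form a H1 V"
    using signed_form_positive_direction[OF a generic] .
  define g where "g Z t = signed_form a H1 Z
        + t / 4 * ((\<Sum>i\<in>UNIV. a $ i * (sphere_lift a H1 t Z $ i)\<^sup>2) + signed_form a Z Z)" for Z t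
  have lim: "(g (W1 + s *\<^sub>R V) \<longlongrightarrow> s * signed_form a H1 V) (at_right 0)" for s
  proof -
    have "(g (W1 + s *\<^sub>R V) \<longlongrightarrow> signed_form a H1 (W1 + s *\<^sub>R V)
        + 0 / 4 * ((\<Sum>i\<in>UNIV. a $ i * ((- a * diag (H1 ** transpose H1)) $ i)\<^sup>2)
        + signed_form a (W1 + s *\<^sub>R V) (W1 + s *\<^sub>R V))) (at_right 0)"
      unfolding g_def by (intro tendsto_intros tendsto_sphere_lift) auto
    then show ?thesis
      by (simp add: signed_form_add_right HW)
  qed
  have key: "\<forall>\<^sub>F t in at_right 0.
       (\<Sum>i\<in>UNIV. sphere_lift a H1 t (W1 + (-\<sigma>) *\<^sub>R V) $ i)
         * (\<Sum>i\<in>UNIV. sphere_lift a H1 t (W1 + \<sigma> *\<^sub>R V) $ i) \<le> 0" if "0 < \<sigma>" for \<sigma>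
  proof -
    have "\<forall>\<^sub>F t in at_right 0. g (W1 + \<sigma> *\<^sub>R V) t > 0"
      using that V(2) by (intro order_tendstoD(1)[OF lim]) simp
    moreover have "\<forall>\<^sub>F t in at_right 0. g (W1 + (-\<sigma>) *\<^sub>R V) t < 0"
      using that V(2) by (intro order_tendstoD(2)[OF lim]) simp
    ultimately show ?thesis
      using eventually_sphere_lift_sum[OF a q, of "W1 + \<sigma> *\<^sub>R V", folded g_def]
        eventually_sphere_lift_sum[OF a q, of "W1 + (-\<sigma>) *\<^sub>R V", folded g_def]
        eventually_at_right_less[of 0]
      by eventually_elim (simp add: mult_le_0_iff zero_le_mult_iff)
  qed
  have "\<forall>\<^sub>F \<sigma> in at_right 0. \<forall>\<^sub>F t in at_right 0.
       (\<Sum>i\<in>UNIV. sphere_lift a H1 t (W1 + (-\<sigma>) *\<^sub>R V) $ i)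
         * (\<Sum>i\<in>UNIV. sphere_lift a H1 t (W1 + \<sigma> *\<^sub>R V) $ i) \<le> 0"
    using eventually_at_right_less[of 0] by (rule eventually_mono) (rule key)
  then show ?thesis
    by (rule inner_tangent2_sign_change[OF a H W V(1)])
qed

text \<open>Here the sum of the lift is of order \<open>t^2\<close>. Up to the factor \<open>- t^2/4\<close> it tends to the value of the
  quadratic form at \<open>W1 + s V\<close>, whose linear part in \<open>s\<close> dominates for small \<open>s\<close>.\<close>

lemma inner_tangent2_degenerate:
  fixes H1 W1 :: "real ^ 'k::finite ^ 'n"
  assumes a: "a \<in> EE" and H: "1 v* H1 = 0" and q: "signed_form a H1 H1 = 0"
    and l: "H1 = outer_prod a l"
    and W: "1 v* W1 = 0" and WW: "signed_form a W1 W1 = 0"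
  shows "first_col (- a * diag (H1 ** transpose H1)) W1
           \<in> inner_tangent2 BB (first_col a 0) (first_col 0 H1)"
proof (cases "W1 \<in> range (outer_prod a)")
  case True
  then obtain m where m: "W1 = outer_prod a m"
    by blast
  \<comment> \<open>No linear part is available here, but all rows have the same length, so the lift is a
    multiple of \<open>a\<close>.\<close>
  have "(\<Sum>i\<in>UNIV. sphere_lift a H1 t W1 $ i) = 0" for t
  proof -
    have "H1 $ i + (t/2) *\<^sub>R W1 $ i = a $ i *\<^sub>R (l + (t/2) *\<^sub>R m)" for i
      by (simp add: l m outer_prod_def vec_eq_iff algebra_simps)
    then have "(H1 $ i + (t/2) *\<^sub>R W1 $ i) \<bullet> (H1 $ i + (t/2) *\<^sub>R W1 $ i)
        = (a $ i * a $ i) * ((l + (t/2) *\<^sub>R m) \<bullet> (l + (t/2) *\<^sub>R m))" for i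
      by (simp only: inner_scaleR_left inner_scaleR_right mult.assoc)
    then have "(H1 $ i + (t/2) *\<^sub>R W1 $ i) \<bullet> (H1 $ i + (t/2) *\<^sub>R W1 $ i)
        = (l + (t/2) *\<^sub>R m) \<bullet> (l + (t/2) *\<^sub>R m)" for i
      using EE_square[OF a, of i] by simp
    then obtain c where c: "(H1 $ i + (t/2) *\<^sub>R W1 $ i) \<bullet> (H1 $ i + (t/2) *\<^sub>R W1 $ i) = c" for i
      by blast
    have "sphere_lift a H1 t W1 $ i = a $ i * (- 2 * c / (1 + sqrt \<bar>1 - t\<^sup>2 * c\<bar>))" for i
      by (simp add: sphere_lift_def c Let_def)
    then have "(\<Sum>i\<in>UNIV. sphere_lift a H1 t W1 $ i)
        = (\<Sum>i\<in>UNIV. a $ i) * (- 2 * c / (1 + sqrt \<bar>1 - t\<^sup>2 * c\<bar>))"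
      by (simp only: sum_distrib_right)
    then show ?thesis
      using EE_sum[OF a] by simp
  qed
  then show ?thesis
    by (intro inner_tangent2_sign_change[OF a H W, of 0]) (simp_all add: vector_one_mult_eq_0_iff)
next
  case False
  then obtain V where V: "1 v* V = 0" "0 < signed_form a W1 V"
    using signed_form_positive_direction[OF a] by blast
  define g where "g Z t = (\<Sum>i\<in>UNIV. a $ i * (sphere_lift a H1 t Z $ i)\<^sup>2) + signed_form a Z Z" for Z t
  have lim: "(g (W1 + s *\<^sub>R V) \<longlongrightarrow> s * (2 * signed_form a W1 V + s * signed_form a V V)) (at_right 0)" for s
  proof -
    have "(g (W1 + s *\<^sub>R V) \<longlongrightarrow> (\<Sum>i\<in>UNIV. a $ i * ((- a * diag (H1 ** transpose H1)) $ i)\<^sup>2)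
        + signed_form a (W1 + s *\<^sub>R V) (W1 + s *\<^sub>R V)) (at_right 0)"
      unfolding g_def by (intro tendsto_intros tendsto_sphere_lift)
    moreover have "(\<Sum>i\<in>UNIV. a $ i * ((- a * diag (H1 ** transpose H1)) $ i)\<^sup>2) = 0"
      by (rule signed_sum_limit_squares[OF a l]) (simp add: diag_mult_transpose_nth)
    moreover have "signed_form a (W1 + s *\<^sub>R V) (W1 + s *\<^sub>R V)
        = s * (2 * signed_form a W1 V + s * signed_form a V V)"
      by (simp add: signed_form_add_scaled WW power2_eq_square algebra_simps)
    ultimately show ?thesis
      by simp
  qed
  have lift_sum: "\<forall>\<^sub>F t in at_right 0. (\<Sum>i\<in>UNIV. sphere_lift a H1 t (W1 + s *\<^sub>R V) $ i)
      = - (t\<^sup>2 / 4 * g (W1 + s *\<^sub>R V) t)" for s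
  proof -
    have "signed_form a H1 (W1 + s *\<^sub>R V) = 0"
      using W V(1) unfolding l signed_form_outer_prod[OF a]
      by (simp add: vector_one_mult_eq_0_iff sum.distrib flip: scaleR_sum_right)
    then show ?thesis
      using eventually_sphere_lift_sum[OF a q, of "W1 + s *\<^sub>R V", folded g_def]
      by (simp add: power2_eq_square mult.assoc)
  qed
  have key: "\<forall>\<^sub>F t in at_right 0.
       (\<Sum>i\<in>UNIV. sphere_lift a H1 t (W1 + (-\<sigma>) *\<^sub>R V) $ i)
         * (\<Sum>i\<in>UNIV. sphere_lift a H1 t (W1 + \<sigma> *\<^sub>R V) $ i) \<le> 0"
    if "0 < \<sigma>" "0 < 2 * signed_form a W1 V + \<sigma> * signed_form a V V"
      "0 < 2 * signed_form a W1 V + (- \<sigma>) * signed_form a V V" for \<sigma>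
  proof -
    have "\<forall>\<^sub>F t in at_right 0. g (W1 + \<sigma> *\<^sub>R V) t > 0"
      using that by (intro order_tendstoD(1)[OF lim]) simp
    moreover have "\<forall>\<^sub>F t in at_right 0. g (W1 + (-\<sigma>) *\<^sub>R V) t < 0"
      by (rule order_tendstoD(2)[OF lim]) (use that in \<open>auto intro: mult_neg_pos\<close>)
    ultimately show ?thesis
      using lift_sum[of \<sigma>] lift_sum[of "-\<sigma>"] eventually_at_right_less[of 0]
      by eventually_elim (simp add: mult_le_0_iff zero_le_mult_iff)
  qed
  have pos: "\<forall>\<^sub>F \<sigma> in at_right 0. 0 < 2 * signed_form a W1 V + (c * \<sigma>) * signed_form a V V" for c
  proof -
    have "((\<lambda>\<sigma>. 2 * signed_form a W1 V + (c * \<sigma>) * signed_form a V V)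
        \<longlongrightarrow> 2 * signed_form a W1 V + (c * 0) * signed_form a V V) (at_right 0)"
      by (intro tendsto_intros)
    from order_tendstoD(1)[OF this, of 0] V(2) show ?thesis
      by simp
  qed
  have "\<forall>\<^sub>F \<sigma> in at_right 0. \<forall>\<^sub>F t in at_right 0.
       (\<Sum>i\<in>UNIV. sphere_lift a H1 t (W1 + (-\<sigma>) *\<^sub>R V) $ i)
         * (\<Sum>i\<in>UNIV. sphere_lift a H1 t (W1 + \<sigma> *\<^sub>R V) $ i) \<le> 0"
    using pos[of 1] pos[of "-1"] eventually_at_right_less[of 0]
    by eventually_elim (rule key, simp_all)
  then show ?thesis
    by (rule inner_tangent2_sign_change[OF a H W V(1)])
qed

theorem proposition3p3:
  fixes a :: "real ^ 'n"
    and R H :: "real ^ ('k::finite option) ^ 'n"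
    and H1 :: "real ^ 'k ^ 'n"
  assumes "a \<in> EE"
    and "R = outer_prod a (axis None 1)"
    and "H = first_col 0 H1"
    and "H \<in> inner_tangent BB R"
  shows "(H1 \<notin> range (outer_prod a) \<longrightarrow>
            inner_tangent2 BB R H = outer_tangent2 BB R H \<and>
            outer_tangent2 BB R H =
              {first_col (- a * diag (H1 ** transpose H1)) W1 | W1 :: real ^ 'k ^ 'n.
                 a \<bullet> diag (H1 ** transpose W1) = 0 \<and> 1 v* W1 = 0}) \<and>
         ((\<exists>l. H1 = outer_prod a l) \<longrightarrow>
            inner_tangent2 BB R H = outer_tangent2 BB R H \<and>
            outer_tangent2 BB R H =
              {first_col (- a * diag (H1 ** transpose H1)) W1 | W1 :: real ^ 'k ^ 'n.
                 a \<bullet> diag (W1 ** transpose W1) = 0 \<and> 1 v* W1 = 0})"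
proof -
  have R: "R = first_col a 0"
    by (simp add: assms(2) outer_prod_axis_None)
  have H: "1 v* H1 = 0" and q: "signed_form a H1 H1 = 0"
    using first_order_constraints[OF assms(1)] assms(3,4) by (simp_all add: R)
  note necessary = outer_tangent2_necessary[OF assms(1) H q, folded R assms(3)]
  have sub: "inner_tangent2 BB R H \<subseteq> outer_tangent2 BB R H"
    by (rule inner_tangent2_subset_outer_tangent2)
  show ?thesis
    unfolding inner_diag_eq_signed_form
  proof (intro conjI impI)
    let ?T = "{first_col (- a * diag (H1 ** transpose H1)) W1 | W1 :: real ^ 'k ^ 'n.
                 signed_form a H1 W1 = 0 \<and> 1 v* W1 = 0}"
    assume "H1 \<notin> range (outer_prod a)"
    then have "?T \<subseteq> inner_tangent2 BB R H"
      using inner_tangent2_generic[OF assms(1) H q, folded R assms(3)] by blast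
    moreover have "outer_tangent2 BB R H \<subseteq> ?T"
      using necessary by blast
    ultimately show "inner_tangent2 BB R H = outer_tangent2 BB R H" "outer_tangent2 BB R H = ?T"
      using sub by auto
  next
    let ?T = "{first_col (- a * diag (H1 ** transpose H1)) W1 | W1 :: real ^ 'k ^ 'n.
                 signed_form a W1 W1 = 0 \<and> 1 v* W1 = 0}"
    assume "\<exists>l. H1 = outer_prod a l"
    then obtain l where l: "H1 = outer_prod a l" ..
    have "?T \<subseteq> inner_tangent2 BB R H"
      using inner_tangent2_degenerate[OF assms(1) H q l, folded R assms(3)] by blast
    moreover have "outer_tangent2 BB R H \<subseteq> ?T"
      using necessary l by blast
    ultimately show "inner_tangent2 BB R H = outer_tangent2 BB R H" "outer_tangent2 BB R H = ?T"
      using sub by auto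
  qed
qed

end
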